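(* Let $m$ be a positive integer and let $n\geq \ell(m)$ be an integer. Then the graph $R(n,\ell(m);m)=L(\ell(m),m)\cup E_{n-\ell(m)}$ on $n$ vertices and $m$ edges is $J$-extremal.
   Context: $J$ is the graph (with loops) on three vertices $a,b,c$ whose edges are $ab$ and a loop at $b$; $c$ is an isolated unlooped vertex. For a simple graph $G$, $j(G)$ denotes the number of maps $\phi:V(G)\to V(J)$ with $\phi(x)\phi(y)\in E(J)$ whenever $xy\in E(G)$. A graph with $n$ vertices and $m$ edges is $J$-extremal if $j(G)\geq j(G')$ for every simple graph $G'$ with $n$ vertices and $m$ edges. The lexicographic order on subsets of $[q]$ is $A<B$ iff $\min(A\triangle B)\in A$; the lex graph $L(q,m)$ has vertex set $[q]$ and edge set the first $m$ two-element subsets of $[q]$ in this order. $E_r$ is the edgeless graph on $r$ vertices. For integers $n,q,m$ with $q\le\min\{n,m+1\}$ and $0\le m\le\binom q2$, $R(n,q;m)=L(q,m)\cup E_{n-q}$ (disjoint union). Finally, $\ell(m)=\max\{q : R(m+1,q;m)\text{ is }J\text{-extremal}\}$, the maximum over admissible $q$. *)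

theory Defs
  imports Complex_Main "HOL-Library.FuncSet"
begin

text \<open>An edge joining \<open>x\<close> and \<open>y\<close> is the set \<open>{x, y}\<close>; a loop at \<open>x\<close> is the singleton \<open>{x}\<close>.\<close>

record 'a graph =
  verts :: "'a set"
  edges :: "'a set set"

definition simple_graph :: "'a graph \<Rightarrow> bool" where
  "simple_graph G \<longleftrightarrow> finite (verts G) \<and> (\<forall>e\<in>edges G. e \<subseteq> verts G \<and> card e = 2)"

text \<open>Maps out of \<open>verts G\<close> are represented by extensional functions, so that each is counted once.\<close>

definition graph_homs :: "'a graph \<Rightarrow> 'b graph \<Rightarrow> ('a \<Rightarrow> 'b) set" where
  "graph_homs G H =
     {\<phi> \<in> verts G \<rightarrow>\<^sub>E verts H. \<forall>x y. {x, y} \<in> edges G \<longrightarrow> {\<phi> x, \<phi> y} \<in> edges H}"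

datatype J_vertex = Ja | Jb | Jc

definition J_graph :: "J_vertex graph" where
  "J_graph = \<lparr>verts = {Ja, Jb, Jc}, edges = {{Ja, Jb}, {Jb}}\<rparr>"

definition j_count :: "'a graph \<Rightarrow> nat" where
  "j_count G = card (graph_homs G J_graph)"

text \<open>The competitors range over graphs with vertices in \<open>nat\<close>; every finite graph is isomorphic
  to one of these.\<close>

definition J_extremal :: "'a graph \<Rightarrow> bool" where
  "J_extremal G \<longleftrightarrow> simple_graph G \<and>
     (\<forall>G' :: nat graph. simple_graph G' \<longrightarrow> card (verts G') = card (verts G) \<longrightarrow>
        card (edges G') = card (edges G) \<longrightarrow> j_count G' \<le> j_count G)"

text \<open>The order is strict; \<open>A \<noteq> B\<close> excludes the meaningless minimum of the empty set.\<close>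

definition lex_less :: "nat set \<Rightarrow> nat set \<Rightarrow> bool" where
  "lex_less A B \<longleftrightarrow> A \<noteq> B \<and> Min ((A - B) \<union> (B - A)) \<in> A"

definition pairs :: "nat \<Rightarrow> nat set set" where
  "pairs q = {e. e \<subseteq> {1..q} \<and> card e = 2}"

text \<open>A pair is among the first \<open>m\<close> iff fewer than \<open>m\<close> pairs precede it.\<close>

definition lex_graph :: "nat \<Rightarrow> nat \<Rightarrow> nat graph" where
  "lex_graph q m =
     \<lparr>verts = {1..q}, edges = {e \<in> pairs q. card {f \<in> pairs q. lex_less f e} < m}\<rparr>"

definition edgeless_graph :: "nat \<Rightarrow> nat graph" where
  "edgeless_graph r = \<lparr>verts = {1..r}, edges = {}\<rparr>"

definition disjoint_union :: "'a graph \<Rightarrow> 'b graph \<Rightarrow> ('a + 'b) graph" where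
  "disjoint_union G H =
     \<lparr>verts = verts G <+> verts H, edges = (`) Inl ` edges G \<union> (`) Inr ` edges H\<rparr>"

text \<open>\<open>R_graph n q m\<close> is meaningful only for \<open>admissible n q m\<close>.\<close>

definition admissible :: "nat \<Rightarrow> nat \<Rightarrow> nat \<Rightarrow> bool" where
  "admissible n q m \<longleftrightarrow> q \<le> min n (m + 1) \<and> m \<le> q choose 2"

definition R_graph :: "nat \<Rightarrow> nat \<Rightarrow> nat \<Rightarrow> (nat + nat) graph" where
  "R_graph n q m = disjoint_union (lex_graph q m) (edgeless_graph (n - q))"

definition ell :: "nat \<Rightarrow> nat" where
  "ell m = Max {q. admissible (m + 1) q m \<and> J_extremal (R_graph (m + 1) q m)}"

end

theory Submission
  imports Defs
begin

text \<open>A homomorphism to \<open>J\<close> is an independent set of non-isolated vertices, the preimage of \<open>Ja\<close>, together with an arbitrary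
  map on the isolated ones, so a graph with \<open>k\<close> non-isolated vertices has \<open>3 ^ (n - k)\<close> times as many
  homomorphisms as independent sets on these \<open>k\<close> vertices. Among graphs with \<open>k\<close> vertices and \<open>m\<close>
  edges the lex graph has the most independent sets: compressing all vertices towards a fixed vertex
  \<open>v\<close> leaves either an isolated vertex or a dominating \<open>v\<close>, and induction applies. So the maximum of
  \<open>j\<close> is attained by some \<open>R(n,q;m)\<close>, and \<open>j(R(n,q;m)) = 3 ^ (n - q) i(L(q,m))\<close> shows that
  the comparison of two values of \<open>q\<close> does not depend on \<open>n\<close>.\<close>

section \<open>Independent sets of graphs with a given number of edges\<close>

definition two_subsets :: "'a set \<Rightarrow> 'a set set" where
  "two_subsets U = {e. e \<subseteq> U \<and> card e = 2}"

definition indep_sets :: "'a set \<Rightarrow> 'a set set \<Rightarrow> 'a set set" where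
  "indep_sets U E = {S. S \<subseteq> U \<and> (\<forall>e\<in>E. \<not> e \<subseteq> S)}"

text \<open>The number of independent sets of \<open>L(n,m)\<close>, meaningful for \<open>m \<le> n choose 2\<close>: vertex 1 is
  the centre of a star with \<open>m\<close> leaves, or it is dominating and can be removed.\<close>

fun lex_indep :: "nat \<Rightarrow> nat \<Rightarrow> nat" where
  "lex_indep 0 m = 1"
| "lex_indep (Suc n) m = (if m \<le> n then 2 ^ n + 2 ^ (n - m) else 1 + lex_indep n (m - n))"

lemma two_subsets_iff: "e \<in> two_subsets U \<longleftrightarrow> (\<exists>x y. x \<in> U \<and> y \<in> U \<and> x \<noteq> y \<and> e = {x, y})"
  by (auto simp: two_subsets_def card_2_iff)

lemma two_subsetsE:
  assumes "e \<in> two_subsets U" "x \<in> e"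
  obtains y where "y \<in> U" "y \<noteq> x" "e = {x, y}"
proof -
  obtain a b where "a \<in> U" "b \<in> U" "a \<noteq> b" "e = {a, b}"
    using assms(1) unfolding two_subsets_iff by blast
  then show thesis
    using assms(2) that[of a] that[of b] by (auto simp: insert_commute)
qed

lemma finite_two_subsets: "finite U \<Longrightarrow> finite (two_subsets U)"
  unfolding two_subsets_def by (rule finite_subset[of _ "Pow U"]) auto

lemma card_two_subsets: "finite U \<Longrightarrow> card (two_subsets U) = card U choose 2"
  by (simp add: two_subsets_def n_subsets)

lemma finite_indep_sets: "finite U \<Longrightarrow> finite (indep_sets U E)"
  unfolding indep_sets_def by (rule finite_subset[of _ "Pow U"]) auto

lemma indep_setsD: "S \<in> indep_sets U E \<Longrightarrow> e \<in> E \<Longrightarrow> \<not> e \<subseteq> S"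
  by (simp add: indep_sets_def)

section \<open>Arithmetic of the recursion \<open>lex_indep\<close>\<close>

lemma choose_two_Suc: "Suc n choose 2 = n + (n choose 2)"
  by (simp add: numeral_2_eq_2)

lemma lex_indep_no_edges: "lex_indep n 0 = 2 ^ n"
  by (cases n) auto

text \<open>The two branches of the recursion agree at \<open>m = n\<close>: a full star is a
  dominating vertex over an edgeless graph.\<close>

lemma lex_indep_Suc: "n \<le> m \<Longrightarrow> lex_indep (Suc n) m = 1 + lex_indep n (m - n)"
  by (cases "m = n") (auto simp: lex_indep_no_edges)

text \<open>In the star range the second power of two is halved by a new edge. Beyond it, removing
  the dominating vertex lowers both edge numbers by \<open>n\<close>, and induction applies.\<close>

lemma lex_indep_strict_decreasing:
  "m < n choose 2 \<Longrightarrow> lex_indep n (Suc m) < lex_indep n m"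
proof (induction n arbitrary: m)
  case (Suc n)
  show ?case
  proof (cases "n \<le> m")
    case True
    then have "m - n < n choose 2"
      using Suc.prems by (simp add: choose_two_Suc)
    from Suc.IH[OF this] show ?thesis
      using True by (simp add: lex_indep_Suc Suc_diff_le del: lex_indep.simps)
  qed auto
qed (simp add: numeral_2_eq_2)

text \<open>Spreading the edges over one more vertex is at least as good as leaving that vertex
  isolated. For a star both sides are equal. Otherwise a dominating vertex is removed on each side;
  this leaves one edge less on the right, and strict monotonicity supplies the missing 1.\<close>

lemma lex_indep_isolated_vertex:
  "m \<le> n choose 2 \<Longrightarrow> 2 * lex_indep n m \<le> lex_indep (Suc n) m"
proof (induction n arbitrary: m)
  case (Suc n)
  show ?case
  proof (cases "m \<le> n")
    case True
    then show ?thesis by (auto simp: Suc_diff_le)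
  next
    case False
    have le: "m - n \<le> n choose 2"
      using Suc.prems by (simp add: choose_two_Suc)
    have "lex_indep (Suc n) (Suc (m - Suc n)) < lex_indep (Suc n) (m - Suc n)"
      using le False by (intro lex_indep_strict_decreasing) (simp add: choose_two_Suc)
    moreover have "Suc (m - Suc n) = m - n"
      using False by simp
    ultimately have "1 + lex_indep (Suc n) (m - n) \<le> lex_indep (Suc n) (m - Suc n)"
      by simp
    then show ?thesis
      using Suc.IH[OF le] False by (simp add: lex_indep_Suc del: lex_indep.simps)
  qed
qed simp

section \<open>Independent sets when a vertex is isolated or dominating, or when all edges form a
  star\<close>

lemma card_indep_sets_isolated:
  assumes "finite U" "u \<in> U" "u \<notin> \<Union>E"
  shows "card (indep_sets U E) = 2 * card (indep_sets (U - {u}) E)"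
proof -
  let ?A = "indep_sets (U - {u}) E"
  have sub: "e \<subseteq> S" if "e \<in> E" "e \<subseteq> insert u S" for e S
    using that assms(3) by auto
  have "S \<in> ?A \<union> insert u ` ?A" if S: "S \<in> indep_sets U E" for S
  proof (cases "u \<in> S")
    case True
    then have "S = insert u (S - {u})" by auto
    moreover have "S - {u} \<in> ?A"
      using S by (auto simp: indep_sets_def)
    ultimately show ?thesis by blast
  qed (use S in \<open>auto simp: indep_sets_def\<close>)
  moreover have "insert u S \<in> indep_sets U E" if "S \<in> ?A" for S
    using that sub[of _ S] assms(2) unfolding indep_sets_def by blast
  moreover have "S \<in> indep_sets U E" if "S \<in> ?A" for S
    using that by (auto simp: indep_sets_def)
  ultimately have eq: "indep_sets U E = ?A \<union> insert u ` ?A"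
    by blast
  have fin: "finite ?A"
    using assms(1) by (simp add: finite_indep_sets)
  have "inj_on (insert u) ?A"
    by (rule inj_onI) (auto simp: indep_sets_def)
  moreover have "?A \<inter> insert u ` ?A = {}"
    by (auto simp: indep_sets_def)
  ultimately show ?thesis
    unfolding eq using fin by (simp add: card_Un_disjoint card_image)
qed

text \<open>The only independent set through \<open>v\<close> is \<open>{v}\<close>.\<close>

lemma card_indep_sets_dominating:
  assumes "finite U" "v \<notin> U" and E: "E \<subseteq> two_subsets U"
  shows "card (indep_sets (insert v U) ((\<lambda>u. {v, u}) ` U \<union> E)) = 1 + card (indep_sets U E)"
proof -
  let ?E = "(\<lambda>u. {v, u}) ` U \<union> E"
  have ne: "\<not> e \<subseteq> {v}" if "e \<in> E" for e
    using that E assms(2) by (auto simp: two_subsets_iff subset_iff)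
  have "S \<in> insert {v} (indep_sets U E)" if S: "S \<in> indep_sets (insert v U) ?E" for S
  proof (cases "v \<in> S")
    case True
    have "x \<notin> S" if "x \<in> U" for x
    proof -
      have "{v, x} \<in> ?E" using that by blast
      then have "\<not> {v, x} \<subseteq> S" by (rule indep_setsD[OF S])
      then show ?thesis using True by simp
    qed
    then show ?thesis using S True by (auto simp: indep_sets_def)
  qed (use S in \<open>auto simp: indep_sets_def\<close>)
  moreover have "{v} \<in> indep_sets (insert v U) ?E"
    using ne assms(2) by (auto simp: indep_sets_def)
  moreover have "S \<in> indep_sets (insert v U) ?E" if "S \<in> indep_sets U E" for S
    using that assms(2) by (auto simp: indep_sets_def)
  ultimately have "indep_sets (insert v U) ?E = insert {v} (indep_sets U E)"
    by blast
  moreover have "{v} \<notin> indep_sets U E"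
    using assms(2) by (auto simp: indep_sets_def)
  ultimately show ?thesis
    using assms by (simp add: finite_indep_sets)
qed

lemma card_star: "v \<notin> U \<Longrightarrow> card ((\<lambda>u. {v, u}) ` U) = card U"
  by (rule card_image) (auto simp: inj_on_def doubleton_eq_iff)

text \<open>The two powers count the independent sets without \<open>v\<close>, which are arbitrary,
  and those with \<open>v\<close>, which avoid \<open>B\<close>.\<close>

lemma card_indep_sets_star:
  assumes "finite U" "v \<notin> U" "B \<subseteq> U"
  shows "card (indep_sets (insert v U) ((\<lambda>u. {v, u}) ` B)) = 2 ^ card U + 2 ^ (card U - card B)"
proof -
  have "insert v ` Pow (U - B) \<subseteq> indep_sets (insert v U) ((\<lambda>u. {v, u}) ` B)"
    using assms by (auto simp: indep_sets_def)
  moreover have "S \<in> Pow U \<union> insert v ` Pow (U - B)"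
    if S: "S \<in> indep_sets (insert v U) ((\<lambda>u. {v, u}) ` B)" for S
  proof (cases "v \<in> S")
    case True
    then have "S = insert v (S - {v})" "S - {v} \<in> Pow (U - B)"
      using S by (auto simp: indep_sets_def)
    then show ?thesis by blast
  qed (use S in \<open>auto simp: indep_sets_def\<close>)
  moreover have "Pow U \<subseteq> indep_sets (insert v U) ((\<lambda>u. {v, u}) ` B)"
    using assms by (auto simp: indep_sets_def)
  ultimately have eq: "indep_sets (insert v U) ((\<lambda>u. {v, u}) ` B) = Pow U \<union> insert v ` Pow (U - B)"
    by blast
  have "inj_on (insert v) (Pow (U - B))"
    using assms by (intro inj_onI) auto
  moreover have "Pow U \<inter> insert v ` Pow (U - B) = {}"
    using assms by auto
  moreover have "finite B"
    using assms finite_subset by blast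
  ultimately show ?thesis
    unfolding eq using assms by (simp add: card_Un_disjoint card_image card_Pow card_Diff_subset)
qed

text \<open>Compression moves every edge \<open>{x, z}\<close> with \<open>z\<close> outside the closed neighbourhood of \<open>v\<close>
  to \<open>{v, z}\<close>. An independent set destroyed by this contains \<open>v\<close> but not \<open>x\<close>;
  exchanging \<open>v\<close> for \<open>x\<close> makes it an independent set that the old graph did not have.\<close>

definition private_nbrs :: "'a set set \<Rightarrow> 'a \<Rightarrow> 'a \<Rightarrow> 'a set" where
  "private_nbrs E x v = {z. z \<noteq> v \<and> {x, z} \<in> E \<and> {v, z} \<notin> E}"

definition compress :: "'a \<Rightarrow> 'a \<Rightarrow> 'a set set \<Rightarrow> 'a set set" where
  "compress x v E =
     (E - (\<lambda>z. {x, z}) ` private_nbrs E x v) \<union> (\<lambda>z. {v, z}) ` private_nbrs E x v"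

lemma private_nbrs_subset:
  assumes "E \<subseteq> two_subsets U"
  shows "private_nbrs E x v \<subseteq> U - {x, v}"
proof
  fix z assume z: "z \<in> private_nbrs E x v"
  then have "{x, z} \<in> two_subsets U" using assms by (auto simp: private_nbrs_def)
  then have "z \<in> U" "x \<noteq> z" by (auto simp: two_subsets_def)
  then show "z \<in> U - {x, v}" using z by (auto simp: private_nbrs_def)
qed

lemma compress_subset:
  assumes "E \<subseteq> two_subsets U" "v \<in> U"
  shows "compress x v E \<subseteq> two_subsets U"
proof
  fix e assume e: "e \<in> compress x v E"
  show "e \<in> two_subsets U"
  proof (cases "e \<in> E")
    case False
    then obtain z where z: "z \<in> private_nbrs E x v" "e = {v, z}"
      using e by (auto simp: compress_def)
    then have "z \<in> U" "v \<noteq> z"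
      using private_nbrs_subset[OF assms(1), of x v] by blast+
    then show ?thesis
      using z assms(2) by (simp add: two_subsets_def)
  next
    case True
    then show ?thesis using assms(1) by (rule rev_subsetD)
  qed
qed

text \<open>Removed and added edges both correspond to the private neighbours, and no added edge was
  present before.\<close>

lemma card_compress:
  assumes "finite U" "E \<subseteq> two_subsets U" "x \<noteq> v"
  shows "card (compress x v E) = card E"
proof -
  let ?P = "private_nbrs E x v"
  have P: "?P \<subseteq> U - {x, v}"
    using assms(2) by (rule private_nbrs_subset)
  have fin: "finite E" "finite ?P"
    using finite_subset[OF assms(2) finite_two_subsets[OF assms(1)]] finite_subset[OF P] assms(1)
    by auto
  have 1: "card ((\<lambda>z. {x, z}) ` ?P) = card ?P" "card ((\<lambda>z. {v, z}) ` ?P) = card ?P"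
    using P card_star[of x ?P] card_star[of v ?P] by blast+
  have 2: "(\<lambda>z. {x, z}) ` ?P \<subseteq> E"
    by (auto simp: private_nbrs_def)
  have 3: "(E - (\<lambda>z. {x, z}) ` ?P) \<inter> (\<lambda>z. {v, z}) ` ?P = {}"
    by (auto simp: private_nbrs_def)
  have "card ?P \<le> card E"
    using card_mono[OF fin(1) 2] 1 by simp
  then show ?thesis
    unfolding compress_def using fin 1
    by (simp add: card_Un_disjoint[OF _ _ 3] card_Diff_subset[OF _ 2])
qed

lemma card_indep_sets_compress:
  assumes "finite U" and E: "E \<subseteq> two_subsets U" and xv: "x \<noteq> v" "x \<in> U"
  shows "card (indep_sets U E) \<le> card (indep_sets U (compress x v E))"
proof -
  let ?P = "private_nbrs E x v" and ?C = "indep_sets U (compress x v E)"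
  \<comment> \<open>This is an injection: \<open>new\<close> keeps exchanged sets apart from the
    surviving ones, which are independent in the old graph, and \<open>bad\<close> makes the
    exchange reversible.\<close>
  define f where "f S = (if S \<in> ?C then S else insert x (S - {v}))" for S
  have P: "?P \<subseteq> U - {x, v}"
    using E by (rule private_nbrs_subset)
  have bad: "v \<in> S \<and> x \<notin> S \<and> (\<exists>z\<in>?P. z \<in> S)" if S: "S \<in> indep_sets U E" "S \<notin> ?C" for S
  proof -
    obtain e where e: "e \<in> compress x v E" "e \<subseteq> S"
      using S by (auto simp: indep_sets_def)
    then have "e \<notin> E" using indep_setsD[OF S(1)] by blast
    then obtain z where z: "z \<in> ?P" "e = {v, z}"
      using e by (auto simp: compress_def)
    moreover have "{x, z} \<in> E" using z by (auto simp: private_nbrs_def)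
    ultimately show ?thesis using indep_setsD[OF S(1), of "{x, z}"] e by auto
  qed
  have new: "insert x (S - {v}) \<in> ?C - indep_sets U E" if S: "S \<in> indep_sets U E" "S \<notin> ?C" for S
  proof -
    let ?T = "insert x (S - {v})"
    have b: "v \<in> S" "x \<notin> S" and "\<exists>z\<in>?P. z \<in> S" using bad[OF S] by auto
    then obtain z where z: "z \<in> ?P" "z \<in> S" by blast
    have "{x, z} \<in> E" "z \<noteq> v" using z by (auto simp: private_nbrs_def)
    then have "?T \<notin> indep_sets U E" using z indep_setsD[of ?T U E "{x, z}"] by auto
    moreover have "\<not> e \<subseteq> ?T" if e: "e \<in> compress x v E" for e
    proof
      assume sub: "e \<subseteq> ?T"
      then have "v \<notin> e" using xv by auto
      then have eE: "e \<in> E" "e \<notin> (\<lambda>z. {x, z}) ` ?P" using e by (auto simp: compress_def)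
      have "x \<in> e"
        using sub indep_setsD[OF S(1) eE(1)] by auto
      moreover have "e \<in> two_subsets U" using eE E by blast
      ultimately obtain w where w: "e = {x, w}" "w \<noteq> x"
        by (metis two_subsetsE)
      then have "w \<in> S" "w \<noteq> v" using sub by auto
      \<comment> \<open>The edge \<open>{x, w}\<close> was not moved, so \<open>w\<close> is not
        private and \<open>{v, w}\<close> was already an edge; but \<open>S\<close> contains both
        \<open>v\<close> and \<open>w\<close>.\<close>
      moreover have "w \<notin> ?P" using eE w by auto
      ultimately have "{v, w} \<in> E" using eE w by (auto simp: private_nbrs_def)
      then show False using indep_setsD[OF S(1), of "{v, w}"] b \<open>w \<in> S\<close> by simp
    qed
    ultimately show ?thesis using S xv by (auto simp: indep_sets_def)
  qed
  have "inj_on f (indep_sets U E)"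
  proof (rule inj_onI)
    fix S T assume ST: "S \<in> indep_sets U E" "T \<in> indep_sets U E" "f S = f T"
    show "S = T"
    proof (cases "S \<in> ?C"; cases "T \<in> ?C")
      assume "S \<in> ?C" "T \<in> ?C" then show ?thesis using ST by (simp add: f_def)
    next
      assume "S \<in> ?C" "T \<notin> ?C" then show ?thesis using ST new[of T] by (auto simp: f_def)
    next
      assume "S \<notin> ?C" "T \<in> ?C" then show ?thesis using ST new[of S] by (auto simp: f_def)
    next
      assume "S \<notin> ?C" "T \<notin> ?C"
      then show ?thesis using ST bad[of S] bad[of T] by (auto simp: f_def)
    qed
  qed
  moreover have "f ` indep_sets U E \<subseteq> ?C"
    using new by (auto simp: f_def)
  ultimately show ?thesis
    using assms finite_indep_sets card_inj_on_le by metis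
qed

text \<open>The outer induction is on the number of vertices. For a fixed \<open>v\<close>, the
  inner one is on the number of vertices not adjacent to \<open>v\<close>: compression towards
  \<open>v\<close> lowers it and keeps the vertex set and the number of edges.\<close>

theorem card_indep_sets_le:
  assumes "finite U" "E \<subseteq> two_subsets U"
  shows "card (indep_sets U E) \<le> lex_indep (card U) (card E)"
  using assms
proof (induction "card U" arbitrary: U E)
  case 0
  then have "U = {}" by simp
  then have "indep_sets U E \<subseteq> {{}}" by (auto simp: indep_sets_def)
  then have "card (indep_sets U E) \<le> card {{} :: 'a set}" by (rule card_mono[rotated]) simp
  then show ?case using 0 by simp
next
  case (Suc n)
  then have "U \<noteq> {}" by auto
  then obtain v where v: "v \<in> U" by blast
  show ?case
    using Suc.prems(2)
  proof (induction "card (U - {z. {v, z} \<in> E})" arbitrary: E rule: less_induct)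
    case (less E)
    have finE: "finite E"
      using less.prems Suc.prems(1) finite_subset finite_two_subsets by blast
    show ?case
    proof (cases "\<exists>x. x \<noteq> v \<and> private_nbrs E x v \<noteq> {}")
      case True
      then obtain x z where x: "x \<noteq> v" and z: "z \<in> private_nbrs E x v" by blast
      have "{x, z} \<in> two_subsets U" using less.prems z by (auto simp: private_nbrs_def)
      then have xU: "x \<in> U" "z \<in> U" by (auto simp: two_subsets_def)
      \<comment> \<open>A moved edge joins \<open>x\<close> to some \<open>z\<close> other than
        \<open>v\<close>, so no edge at \<open>v\<close> is lost.\<close>
      have keep: "{v, y} \<in> compress x v E" if "{v, y} \<in> E" for y
        using that x by (auto simp: compress_def private_nbrs_def doubleton_eq_iff)
      have "{v, z} \<in> compress x v E" "{v, z} \<notin> E"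
        using z by (auto simp: compress_def private_nbrs_def)
      then have "U - {z. {v, z} \<in> compress x v E} \<subset> U - {z. {v, z} \<in> E}"
        using keep xU by blast
      then have "card (U - {z. {v, z} \<in> compress x v E}) < card (U - {z. {v, z} \<in> E})"
        using Suc.prems(1) by (intro psubset_card_mono) auto
      then have "card (indep_sets U (compress x v E)) \<le> lex_indep (card U) (card E)"
        using less.hyps[OF _ compress_subset[OF less.prems v], of x]
          card_compress[OF Suc.prems(1) less.prems x] by simp
      then show ?thesis
        using card_indep_sets_compress[OF Suc.prems(1) less.prems x xU(1)] by linarith
    next
      case False
      then have closed: "{v, z} \<in> E" if "x \<noteq> v" "z \<noteq> v" "{x, z} \<in> E" for x z
        using that by (auto simp: private_nbrs_def)
      show ?thesis
      proof (cases "U \<subseteq> \<Union>E")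
        case False
        then obtain u where u: "u \<in> U" "u \<notin> \<Union>E" by blast
        have cU: "card (U - {u}) = n" using u Suc by simp
        have E: "E \<subseteq> two_subsets (U - {u})"
          using less.prems u by (auto simp: two_subsets_def)
        have "card E \<le> n choose 2"
          using card_mono[OF finite_two_subsets E] Suc.prems(1) card_two_subsets[of "U - {u}"] cU by simp
        then have "2 * lex_indep n (card E) \<le> lex_indep (Suc n) (card E)"
          by (rule lex_indep_isolated_vertex)
        moreover have "card (indep_sets (U - {u}) E) \<le> lex_indep n (card E)"
          using Suc.hyps(1)[of "U - {u}" E] Suc.prems(1) E cU by simp
        ultimately show ?thesis
          using card_indep_sets_isolated[OF Suc.prems(1) u] Suc.hyps(2) by simp
      next
        case True
        let ?W = "U - {v}"
        let ?star = "(\<lambda>u. {v, u}) ` ?W"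
        \<comment> \<open>Every \<open>u\<close> other than \<open>v\<close> lies on an edge
          \<open>{u, w}\<close>. If \<open>w\<close> is not \<open>v\<close>, then \<open>u\<close>
          would be a private neighbour of \<open>w\<close> unless \<open>{v, u}\<close> is an
          edge.\<close>
        have star: "?star \<subseteq> E"
        proof
          fix e assume "e \<in> ?star"
          then obtain u where u: "u \<in> U" "u \<noteq> v" "e = {v, u}" by auto
          then obtain f where f: "f \<in> E" "u \<in> f" using True by blast
          then have "f \<in> two_subsets U" using less.prems by blast
          then obtain w where w: "f = {u, w}" using f(2) by (rule two_subsetsE)
          show "e \<in> E"
          proof (cases "w = v")
            case True
            then show ?thesis using u f w by (simp add: insert_commute)
          next
            case False
            then show ?thesis
              using closed[of w u] u f w by (simp add: insert_commute)
          qed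
        qed
        have cW: "card ?W = n" using Suc v by simp
        have rest: "E - ?star \<subseteq> two_subsets ?W"
        proof
          fix e assume e: "e \<in> E - ?star"
          then have "e \<in> two_subsets U" using less.prems by blast
          moreover have "v \<notin> e"
          proof
            assume "v \<in> e"
            then obtain y where "y \<in> U" "y \<noteq> v" "e = {v, y}"
              using \<open>e \<in> two_subsets U\<close> by (metis two_subsetsE)
            then show False using e by blast
          qed
          ultimately show "e \<in> two_subsets ?W"
            by (auto simp: two_subsets_def)
        qed
        have c: "card (E - ?star) = card E - n" "n \<le> card E"
          using star finE cW card_star[of v ?W] Suc.prems(1) card_mono[OF finE star]
          by (simp_all add: card_Diff_subset)
        have "card (indep_sets (insert v ?W) (?star \<union> (E - ?star))) = 1 + card (indep_sets ?W (E - ?star))"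
          using rest Suc.prems(1) by (intro card_indep_sets_dominating) auto
        moreover have "insert v ?W = U" "?star \<union> (E - ?star) = E"
          using v star by auto
        moreover have "card (indep_sets ?W (E - ?star)) \<le> lex_indep n (card E - n)"
          using Suc.hyps(1)[of ?W "E - ?star"] rest Suc.prems(1) cW c by simp
        ultimately show ?thesis
          using lex_indep_Suc[OF c(2)] Suc.hyps(2) by simp
      qed
    qed
  qed
qed

section \<open>Lex graphs\<close>

text \<open>Adding a new maximum \<open>x\<close> to \<open>A\<close> changes no other rank, and
  \<open>x\<close> itself gets rank \<open>card A\<close>. This will count the leaves of the star at
  the least vertex of a lex graph.\<close>

lemma card_initial_segment:
  fixes A :: "'a::linorder set"
  assumes "finite A" "m \<le> card A"
  shows "card {b \<in> A. card {c \<in> A. c < b} < m} = m"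
  using assms
proof (induction arbitrary: m rule: finite_linorder_max_induct)
  case (insert x A)
  have x: "x \<notin> A" using insert.hyps by auto
  have 1: "{c \<in> insert x A. c < b} = {c \<in> A. c < b}" if "b \<in> A" for b
    using that insert.hyps by auto
  have 2: "{c \<in> insert x A. c < x} = A"
    using insert.hyps by auto
  show ?case
  proof (cases "m \<le> card A")
    case True
    then have "{b \<in> insert x A. card {c \<in> insert x A. c < b} < m} = {b \<in> A. card {c \<in> A. c < b} < m}"
      using 1 2 x by auto
    then show ?thesis using insert.IH[OF True] by simp
  next
    case False
    have "card {c \<in> insert x A. c < b} < m" if "b \<in> insert x A" for b
    proof -
      have "{c \<in> insert x A. c < b} \<subseteq> insert x A - {b}" by auto
      then have "card {c \<in> insert x A. c < b} \<le> card (insert x A - {b})"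
        using insert.hyps by (intro card_mono) auto
      also have "\<dots> = card A" using that x insert.hyps by simp
      finally show ?thesis using False by simp
    qed
    then have "{b \<in> insert x A. card {c \<in> insert x A. c < b} < m} = insert x A" by auto
    moreover have "m = Suc (card A)" using False insert.prems x insert.hyps by simp
    ultimately show ?thesis using x insert.hyps by simp
  qed
qed simp

text \<open>The ground set is arbitrary so that the least vertex can be removed in an
  induction.\<close>

definition lex_edges :: "nat set \<Rightarrow> nat \<Rightarrow> nat set set" where
  "lex_edges A m = {e \<in> two_subsets A. card {f \<in> two_subsets A. lex_less f e} < m}"

lemma edges_lex_graph: "edges (lex_graph q m) = lex_edges {1..q} m"
  by (simp add: lex_graph_def lex_edges_def pairs_def two_subsets_def)

lemma verts_lex_graph: "verts (lex_graph q m) = {1..q}"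
  by (simp add: lex_graph_def)

lemma lex_edges_subset: "lex_edges A m \<subseteq> two_subsets A"
  by (auto simp: lex_edges_def)

text \<open>The least element of the symmetric difference is \<open>a\<close>. Hence all edges at
  the least vertex come before all other edges.\<close>

lemma lex_less_if_new_min:
  fixes a :: nat
  assumes "finite e" "finite f" "a \<in> e" "\<forall>x\<in>f. a < x" "\<forall>x\<in>e. a \<le> x"
  shows "lex_less e f" "\<not> lex_less f e"
proof -
  have "Min ((e - f) \<union> (f - e)) = a"
    using assms by (intro Min_eqI) (auto intro: less_imp_le)
  moreover have "Min ((f - e) \<union> (e - f)) = a"
    using assms by (intro Min_eqI) (auto intro: less_imp_le)
  ultimately show "lex_less e f" "\<not> lex_less f e"
    using assms by (auto simp: lex_less_def)
qed

lemma lex_less_same_min: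
  fixes a b c :: nat
  assumes "a < b" "a < c"
  shows "lex_less {a, b} {a, c} \<longleftrightarrow> b < c"
proof (cases "b = c")
  case False
  then have "({a, b} - {a, c}) \<union> ({a, c} - {a, b}) = {b, c}"
    using assms by auto
  then show ?thesis
    using False assms by (auto simp: lex_less_def doubleton_eq_iff min_def)
qed (simp add: lex_less_def)

lemma two_subsets_insert:
  assumes "a \<notin> B"
  shows "two_subsets (insert a B) = (\<lambda>b. {a, b}) ` B \<union> two_subsets B"
proof (intro equalityI subsetI)
  fix e assume e: "e \<in> two_subsets (insert a B)"
  show "e \<in> (\<lambda>b. {a, b}) ` B \<union> two_subsets B"
  proof (cases "a \<in> e")
    case True
    with e obtain b where "b \<in> insert a B" "b \<noteq> a" "e = {a, b}"
      by (rule two_subsetsE)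
    then show ?thesis by blast
  next
    case False
    with e show ?thesis by (auto simp: two_subsets_def)
  qed
next
  fix e assume "e \<in> (\<lambda>b. {a, b}) ` B \<union> two_subsets B"
  moreover have "{a, b} \<in> two_subsets (insert a B)" if "b \<in> B" for b
    using that assms by (cases "a = b") (auto simp: two_subsets_def)
  ultimately show "e \<in> two_subsets (insert a B)"
    by (auto simp: two_subsets_def)
qed

text \<open>An edge \<open>{a, b}\<close> has the rank of \<open>b\<close> in \<open>B\<close>,
  while an edge inside \<open>B\<close> is preceded by the whole star at \<open>a\<close>, which
  shifts its rank by \<open>card B\<close>.\<close>

lemma lex_edges_insert:
  assumes "finite B" and a: "\<forall>b\<in>B. a < b"
  shows "lex_edges (insert a B) m =
    (\<lambda>b. {a, b}) ` {b \<in> B. card {c \<in> B. c < b} < m} \<union> lex_edges B (m - card B)"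
proof -
  have aB: "a \<notin> B" using a by auto
  let ?star = "(\<lambda>b. {a, b}) ` B" and ?r = "\<lambda>e. {f \<in> two_subsets (insert a B). lex_less f e}"
  have disj: "?star \<inter> two_subsets B = {}"
    using aB by (auto simp: two_subsets_def)
  have above: "lex_less {a, b} e \<and> \<not> lex_less e {a, b}" if "b \<in> B" "e \<in> two_subsets B" for b e
  proof -
    have "finite e" "\<forall>x\<in>e. a < x"
      using that a by (auto simp: two_subsets_iff)
    then show ?thesis
      using lex_less_if_new_min[of "{a, b}" e a] that a by auto
  qed
  have 1: "card (?r {a, b}) = card {c \<in> B. c < b}" if "b \<in> B" for b
  proof -
    have "?r {a, b} = (\<lambda>b. {a, b}) ` {c \<in> B. c < b}"
      using that a above lex_less_same_min aB by (auto simp: two_subsets_insert)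
    then show ?thesis using aB by (simp add: card_star)
  qed
  have 2: "card (?r e) = card B + card {f \<in> two_subsets B. lex_less f e}" if "e \<in> two_subsets B" for e
  proof -
    have "?r e = ?star \<union> {f \<in> two_subsets B. lex_less f e}"
      using that above aB by (auto simp: two_subsets_insert)
    moreover have "card \<dots> = card ?star + card {f \<in> two_subsets B. lex_less f e}"
      using disj assms(1) finite_two_subsets[of B] by (intro card_Un_disjoint) auto
    ultimately show ?thesis using aB by (simp add: card_star)
  qed
  have "lex_edges (insert a B) m = {e \<in> ?star. card (?r e) < m} \<union> {e \<in> two_subsets B. card (?r e) < m}"
    using two_subsets_insert[OF aB] by (auto simp: lex_edges_def)
  also have "{e \<in> ?star. card (?r e) < m} = (\<lambda>b. {a, b}) ` {b \<in> B. card {c \<in> B. c < b} < m}"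
    using 1 by auto
  also have "{e \<in> two_subsets B. card (?r e) < m} = lex_edges B (m - card B)"
    using 2 by (auto simp: lex_edges_def)
  finally show ?thesis .
qed

lemma lex_edges_insert_dominating:
  assumes "finite B" "\<forall>b\<in>B. a < b" "card B \<le> m"
  shows "lex_edges (insert a B) m = (\<lambda>b. {a, b}) ` B \<union> lex_edges B (m - card B)"
proof -
  have "card {c \<in> B. c < b} < m" if "b \<in> B" for b
  proof -
    have "card {c \<in> B. c < b} < card B"
      using that assms(1) by (intro psubset_card_mono) auto
    then show ?thesis using assms(3) by simp
  qed
  then have "{b \<in> B. card {c \<in> B. c < b} < m} = B" by auto
  then show ?thesis using lex_edges_insert[OF assms(1,2), of m] by simp
qed

text \<open>Removing the least vertex reproduces the recursion of \<open>lex_indep\<close>: that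
  vertex is dominating, or the graph is a star with \<open>m\<close> leaves. So the bound of
  \<open>card_indep_sets_le\<close> is attained.\<close>

lemma card_indep_sets_lex_edges:
  assumes "finite A" "m \<le> card A choose 2"
  shows "card (lex_edges A m) = m \<and> card (indep_sets A (lex_edges A m)) = lex_indep (card A) m"
  using assms
proof (induction arbitrary: m rule: finite_linorder_min_induct)
  case empty
  then have "m = 0" by (simp add: numeral_2_eq_2)
  then show ?case by (simp add: lex_edges_def indep_sets_def)
next
  case (insert a B)
  have aB: "a \<notin> B" using insert.hyps by auto
  have c: "card (insert a B) = Suc (card B)" using aB insert.hyps by simp
  show ?case
  proof (cases "card B \<le> m")
    case True
    have "m - card B \<le> card B choose 2"
      using insert.prems c by (simp add: choose_two_Suc)
    note IH = insert.IH[OF this]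
    note eq = lex_edges_insert_dominating[OF insert.hyps(1) _ True, of a]
    have "finite (lex_edges B (m - card B))"
      using lex_edges_subset finite_two_subsets insert.hyps(1) finite_subset by metis
    moreover have "(\<lambda>b. {a, b}) ` B \<inter> lex_edges B (m - card B) = {}"
      using lex_edges_subset[of B] aB by (fastforce simp: two_subsets_def)
    ultimately have "card (lex_edges (insert a B) m) = m"
      using True IH aB insert.hyps eq by (simp add: card_Un_disjoint card_star)
    moreover have "card (indep_sets (insert a B) (lex_edges (insert a B) m)) = lex_indep (card (insert a B)) m"
      using eq insert.hyps card_indep_sets_dominating[OF insert.hyps(1) aB lex_edges_subset] IH
        lex_indep_Suc[OF True] by (simp add: c del: lex_indep.simps)
    ultimately show ?thesis by blast
  next
    case False
    let ?L = "{b \<in> B. card {c \<in> B. c < b} < m}"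
    have L: "card ?L = m"
      using False insert.hyps(1) by (intro card_initial_segment) auto
    \<comment> \<open>Here \<open>m < card B\<close>, so the truncated difference is 0 and no edge
      lies outside the star.\<close>
    have "lex_edges B (m - card B) = {}"
      using False by (simp add: lex_edges_def)
    then have eq: "lex_edges (insert a B) m = (\<lambda>b. {a, b}) ` ?L"
      using lex_edges_insert[of B a m] insert.hyps by simp
    then have "card (lex_edges (insert a B) m) = m"
      using aB L by (simp add: card_star)
    moreover have "card (indep_sets (insert a B) (lex_edges (insert a B) m)) = 2 ^ card B + 2 ^ (card B - m)"
      unfolding eq using insert.hyps(1) aB L by (subst card_indep_sets_star) auto
    ultimately show ?thesis using False c by simp
  qed
qed

text \<open>At least \<open>q - 1\<close> edges are available, so vertex 1 is dominating and no
  vertex is isolated.\<close>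

lemma Union_lex_edges:
  assumes "2 \<le> q" "q \<le> Suc m"
  shows "\<Union>(lex_edges {1..q} m) = {1..q}"
proof -
  have "{1..q} = insert 1 {2..q}" using assms by auto
  then have "lex_edges {1..q} m = (\<lambda>b. {1, b}) ` {2..q} \<union> lex_edges {2..q} (m - card {2..q})"
    using lex_edges_insert_dominating[of "{2..q}" 1 m] assms by auto
  moreover have "\<Union>((\<lambda>b. {1, b}) ` {2..q}) = {1..q}"
    using assms by (auto simp: not_less_eq_eq Suc_le_eq)
  moreover have "\<Union>(lex_edges {2..q} (m - card {2..q})) \<subseteq> {1..q}"
  proof (rule Union_least)
    fix e assume "e \<in> lex_edges {2..q} (m - card {2..q})"
    then have "e \<subseteq> {2..q}" by (simp add: lex_edges_def two_subsets_def)
    then show "e \<subseteq> {1..q}" by auto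
  qed
  ultimately show ?thesis by (simp only: Union_Un_distrib Un_absorb2)
qed

section \<open>Homomorphisms to \<open>J\<close>\<close>

lemma edges_subset_two_subsets: "simple_graph G \<Longrightarrow> edges G \<subseteq> two_subsets (\<Union>(edges G))"
  by (auto simp: simple_graph_def two_subsets_def)

lemma Union_edges_subset: "simple_graph G \<Longrightarrow> \<Union>(edges G) \<subseteq> verts G"
  by (auto simp: simple_graph_def)

lemma J_edge_iff:
  "{s, t} \<in> edges J_graph \<longleftrightarrow> s \<in> {Ja, Jb} \<and> t \<in> {Ja, Jb} \<and> \<not> (s = Ja \<and> t = Ja)"
  by (cases s; cases t) (auto simp: J_graph_def doubleton_eq_iff)

lemma j_count_eq:
  assumes G: "simple_graph G"
  shows "j_count G =
    3 ^ (card (verts G) - card (\<Union>(edges G))) * card (indep_sets (\<Union>(edges G)) (edges G))"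
proof -
  define E where "E = edges G"
  define N where "N = \<Union>E"
  define I where "I = verts G - N"
  define f where "f \<phi> = ({x \<in> N. \<phi> x = Ja}, restrict \<phi> I)" for \<phi>
  \<comment> \<open>Outside \<open>verts G\<close> the value comes from \<open>\<psi>\<close>, which
    is \<open>undefined\<close> there, so the glued map is extensional.\<close>
  define g where "g = (\<lambda>(S, \<psi>) x. if x \<in> N then (if x \<in> S then Ja else Jb) else \<psi> x)"
  let ?T = "indep_sets N E \<times> (I \<rightarrow>\<^sub>E verts J_graph)"
  have fin: "finite (verts G)" using G by (simp add: simple_graph_def)
  have NV: "N \<subseteq> verts G" using Union_edges_subset[OF G] by (simp add: N_def E_def)
  have E2: "E \<subseteq> two_subsets N" using edges_subset_two_subsets[OF G] by (simp add: N_def E_def)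
  have hom: "{\<phi> x, \<phi> y} \<in> edges J_graph" if "\<phi> \<in> graph_homs G J_graph" "{x, y} \<in> E" for \<phi> x y
    using that by (simp add: graph_homs_def E_def)
  \<comment> \<open>A vertex on an edge cannot go to \<open>Jc\<close>, so on \<open>N\<close> the
    preimage of \<open>Ja\<close> determines the map.\<close>
  have ab: "\<phi> x \<in> {Ja, Jb}" if \<phi>: "\<phi> \<in> graph_homs G J_graph" and x: "x \<in> N" for \<phi> x
  proof -
    obtain e where e: "e \<in> E" "x \<in> e" using x by (auto simp: N_def)
    then have "e \<in> two_subsets N" using E2 by blast
    then obtain y where "e = {x, y}" using e(2) by (rule two_subsetsE)
    then show ?thesis using hom[OF \<phi>, of x y] e by (simp add: J_edge_iff)
  qed
  have f_in: "f \<phi> \<in> ?T" if \<phi>: "\<phi> \<in> graph_homs G J_graph" for \<phi>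
  proof -
    have "\<not> e \<subseteq> {x \<in> N. \<phi> x = Ja}" if e: "e \<in> E" for e
    proof
      assume sub: "e \<subseteq> {x \<in> N. \<phi> x = Ja}"
      have "e \<in> two_subsets N" using e E2 by blast
      then obtain x y where "e = {x, y}" unfolding two_subsets_iff by blast
      then show False using hom[OF \<phi>, of x y] e sub by (simp add: J_edge_iff)
    qed
    then have "{x \<in> N. \<phi> x = Ja} \<in> indep_sets N E" by (simp add: indep_sets_def)
    moreover have "restrict \<phi> I \<in> I \<rightarrow>\<^sub>E verts J_graph"
      using \<phi> by (auto simp: graph_homs_def I_def)
    ultimately show ?thesis by (simp add: f_def)
  qed
  have g_in: "g (S, \<psi>) \<in> graph_homs G J_graph"
    if S: "S \<in> indep_sets N E" and \<psi>: "\<psi> \<in> I \<rightarrow>\<^sub>E verts J_graph" for S \<psi>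
  proof -
    have "g (S, \<psi>) x \<in> verts J_graph" if "x \<in> verts G" for x
      using that \<psi> by (auto simp: g_def I_def J_graph_def PiE_iff)
    moreover have "g (S, \<psi>) x = undefined" if "x \<notin> verts G" for x
      using that \<psi> NV by (auto simp: g_def I_def PiE_iff extensional_def)
    ultimately have "g (S, \<psi>) \<in> verts G \<rightarrow>\<^sub>E verts J_graph"
      by (simp add: PiE_iff extensional_def)
    moreover have "{g (S, \<psi>) x, g (S, \<psi>) y} \<in> edges J_graph" if "{x, y} \<in> E" for x y
    proof -
      have "x \<in> N" "y \<in> N" using that by (auto simp: N_def)
      moreover have "\<not> {x, y} \<subseteq> S" using indep_setsD[OF S that] .
      ultimately show ?thesis by (simp add: J_edge_iff g_def)
    qed
    ultimately show ?thesis by (simp add: graph_homs_def E_def)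
  qed
  have gf: "g (f \<phi>) = \<phi>" if \<phi>: "\<phi> \<in> graph_homs G J_graph" for \<phi>
  proof
    fix x
    show "g (f \<phi>) x = \<phi> x"
    proof (cases "x \<in> N")
      case True
      then show ?thesis using ab[OF \<phi>, of x] by (auto simp: g_def f_def)
    next
      case False
      moreover have "\<phi> x = undefined" if "x \<notin> verts G"
        using that \<phi> by (auto simp: graph_homs_def PiE_iff extensional_def)
      ultimately show ?thesis by (auto simp: g_def f_def I_def restrict_def)
    qed
  qed
  have fg: "f (g (S, \<psi>)) = (S, \<psi>)"
    if S: "S \<in> indep_sets N E" and \<psi>: "\<psi> \<in> I \<rightarrow>\<^sub>E verts J_graph" for S \<psi>
  proof -
    have "{x \<in> N. g (S, \<psi>) x = Ja} = S"
      using S by (auto simp: g_def indep_sets_def)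
    moreover have "restrict (g (S, \<psi>)) I x = \<psi> x" for x
      using \<psi> by (auto simp: g_def I_def restrict_def PiE_iff extensional_def)
    ultimately show ?thesis by (auto simp: f_def)
  qed
  have "bij_betw f (graph_homs G J_graph) ?T"
    by (rule bij_betwI[where g = g]) (use f_in g_in gf fg in auto)
  then have "j_count G = card ?T"
    by (simp add: j_count_def bij_betw_same_card)
  moreover have "card (verts J_graph) = 3" by (simp add: J_graph_def)
  moreover have "card I = card (verts G) - card N"
    unfolding I_def using NV fin finite_subset by (intro card_Diff_subset) auto
  moreover have "finite I" using fin by (simp add: I_def)
  ultimately show ?thesis
    by (simp add: card_cartesian_product card_PiE N_def E_def)
qed

section \<open>The graphs \<open>R_graph n q m\<close> as maximisers of
  \<open>j_count\<close>\<close>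

lemma card_indep_sets_image:
  assumes "inj f"
  shows "card (indep_sets (f ` U) ((`) f ` E)) = card (indep_sets U E)"
proof -
  have "indep_sets (f ` U) ((`) f ` E) = (`) f ` indep_sets U E"
  proof (intro equalityI subsetI)
    fix T assume T: "T \<in> indep_sets (f ` U) ((`) f ` E)"
    then have "T \<subseteq> f ` U" by (simp add: indep_sets_def)
    then obtain S where S: "S \<subseteq> U" "T = f ` S" by (rule subset_imageE)
    have "\<not> e \<subseteq> S" if e: "e \<in> E" for e
    proof -
      have "\<not> f ` e \<subseteq> f ` S" using indep_setsD[OF T[unfolded S]] e by blast
      then show ?thesis by (meson image_mono)
    qed
    then have "S \<in> indep_sets U E" using S by (simp add: indep_sets_def)
    then show "T \<in> (`) f ` indep_sets U E" using S by blast
  next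
    fix T assume "T \<in> (`) f ` indep_sets U E"
    then obtain S where "S \<in> indep_sets U E" "T = f ` S" by (rule imageE)
    then show "T \<in> indep_sets (f ` U) ((`) f ` E)"
      using assms by (simp add: indep_sets_def inj_image_subset_iff image_mono)
  qed
  moreover have "inj_on ((`) f) A" for A
    using assms by (auto simp: inj_on_def inj_image_eq_iff)
  ultimately show ?thesis by (simp add: card_image)
qed

lemma admissible_bounds:
  assumes "admissible n q m" "m > 0"
  shows "2 \<le> q" "q \<le> n" "q \<le> Suc m" "m \<le> q choose 2"
proof -
  show "q \<le> n" "q \<le> Suc m" "m \<le> q choose 2"
    using assms by (auto simp: admissible_def)
  then have "q choose 2 \<noteq> 0" using assms(2) by linarith
  then show "2 \<le> q" using binomial_eq_0[of q 2] by (meson not_less)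
qed

lemma lex_edges_properties:
  assumes "admissible n q m" "m > 0"
  shows "card (lex_edges {1..q} m) = m" "\<Union>(lex_edges {1..q} m) = {1..q}"
    "card (indep_sets {1..q} (lex_edges {1..q} m)) = lex_indep q m"
  using card_indep_sets_lex_edges[of "{1..q}" m] Union_lex_edges[of q m] admissible_bounds[OF assms]
  by auto

text \<open>The lex part of an admissible graph has no isolated vertex, so exactly
  \<open>n - q\<close> vertices are isolated and \<open>j_count_eq\<close> gives the
  product.\<close>

lemma R_graph_properties:
  assumes "admissible n q m" "m > 0"
  shows "simple_graph (R_graph n q m)" "card (verts (R_graph n q m)) = n"
    "card (edges (R_graph n q m)) = m" "j_count (R_graph n q m) = 3 ^ (n - q) * lex_indep q m"
proof -
  note L = lex_edges_properties[OF assms]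
  let ?L = "lex_edges {1..q} m"
  have V: "verts (R_graph n q m) = {1..q} <+> {1..n - q}"
    and E: "edges (R_graph n q m) = (`) Inl ` ?L"
    by (simp_all only: R_graph_def disjoint_union_def edgeless_graph_def edges_lex_graph
        graph.simps image_empty Un_empty_right verts_lex_graph)
  have inj: "inj_on ((`) (Inl :: nat \<Rightarrow> nat + nat)) A" for A
    by (auto simp: inj_on_def inj_image_eq_iff)
  show cV: "card (verts (R_graph n q m)) = n"
    using V admissible_bounds[OF assms] by (simp add: card_Plus)
  show "card (edges (R_graph n q m)) = m"
    using E L inj by (simp add: card_image)
  show s: "simple_graph (R_graph n q m)"
    unfolding simple_graph_def V E
  proof (intro conjI ballI)
    fix e :: "(nat + nat) set" assume "e \<in> (`) Inl ` ?L"
    then obtain d where d: "e = Inl ` d" "d \<subseteq> {1..q}" "card d = 2"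
      by (auto simp: lex_edges_def two_subsets_def)
    show "e \<subseteq> {1..q} <+> {1..n - q}" using d by auto
    show "card e = 2" using d by (simp add: card_image)
  qed simp
  have "\<Union>(edges (R_graph n q m)) = Inl ` {1..q}"
    unfolding E using L(2) by (metis image_Union)
  then show "j_count (R_graph n q m) = 3 ^ (n - q) * lex_indep q m"
    using j_count_eq[OF s] cV E L card_indep_sets_image[of Inl "{1..q}" ?L]
    by (simp add: card_image)
qed

text \<open>The witness is the number \<open>k\<close> of non-isolated vertices of \<open>G\<close>,
  replaced by \<open>m + 1\<close> when \<open>k\<close> exceeds this bound.\<close>

lemma j_count_le:
  assumes G: "simple_graph G" and n: "card (verts G) = n" and m: "card (edges G) = m" "m > 0"
  shows "\<exists>q. admissible n q m \<and> j_count G \<le> 3 ^ (n - q) * lex_indep q m"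
proof -
  define N where "N = \<Union>(edges G)"
  define k where "k = card N"
  have fin: "finite (verts G)" using G by (simp add: simple_graph_def)
  have NV: "N \<subseteq> verts G" using Union_edges_subset[OF G] by (simp add: N_def)
  have finN: "finite N" using NV fin by (rule finite_subset)
  have E: "edges G \<subseteq> two_subsets N" using edges_subset_two_subsets[OF G] by (simp add: N_def)
  have kn: "k \<le> n" using card_mono[OF fin NV] n by (simp add: k_def)
  have mk: "m \<le> k choose 2"
    using card_mono[OF finite_two_subsets[OF finN] E] m card_two_subsets[OF finN] by (simp add: k_def)
  have "j_count G = 3 ^ (n - k) * card (indep_sets N (edges G))"
    using j_count_eq[OF G] n by (simp add: N_def k_def)
  moreover have "card (indep_sets N (edges G)) \<le> lex_indep k m"
    using card_indep_sets_le[OF finN E] m by (simp add: k_def)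
  ultimately have j: "j_count G \<le> 3 ^ (n - k) * lex_indep k m" by simp
  show ?thesis
  proof (cases "k \<le> Suc m")
    case True
    then have "admissible n k m" using kn mk by (simp add: admissible_def)
    then show ?thesis using j by blast
  next
    case False
    then obtain t where t: "k = Suc m + t" using less_imp_add_positive[of "Suc m" k] by auto
    have "m \<le> Suc m choose 2" by (simp add: choose_two_Suc)
    then have "admissible n (Suc m) m" using t kn by (simp add: admissible_def)
    \<comment> \<open>The lex graph on \<open>k\<close> vertices is a star on \<open>m + 1\<close>
      vertices with \<open>t\<close> isolated ones. Each of these counts 2 for independent sets but
      3 for homomorphisms, so \<open>m + 1\<close> does at least as well as
      \<open>k\<close>.\<close>
    moreover have "lex_indep k m = 2 ^ t * lex_indep (Suc m) m"
      using t by (simp add: power_add algebra_simps)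
    moreover have "3 ^ (n - Suc m) = 3 ^ (n - k) * (3 :: nat) ^ t"
      using t kn by (simp flip: power_add)
    moreover have "(2 :: nat) ^ t \<le> 3 ^ t" by (rule power_mono) auto
    ultimately show ?thesis
      using j by (intro exI[of _ "Suc m"]) (auto intro: order_trans mult_le_mono simp del: lex_indep.simps)
  qed
qed

text \<open>Multiplication by \<open>3 ^ (p + q)\<close> turns both sides into multiples of
  \<open>3 ^ n\<close>, which cancels. Thus \<open>n\<close> drops out of the comparison.\<close>

lemma power_diff_mult_le_iff:
  fixes x y :: nat
  assumes "p \<le> n" "q \<le> n"
  shows "3 ^ (n - p) * x \<le> 3 ^ (n - q) * y \<longleftrightarrow> 3 ^ q * x \<le> 3 ^ p * y"
proof -
  have "(3 :: nat) ^ (p + q) * (3 ^ (n - p) * x) = 3 ^ n * (3 ^ q * x)"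
    using assms by (simp flip: power_add mult.assoc)
  moreover have "(3 :: nat) ^ (p + q) * (3 ^ (n - q) * y) = 3 ^ n * (3 ^ p * y)"
    using assms by (simp flip: power_add mult.assoc add: add.commute add.left_commute)
  ultimately show ?thesis
    by (metis mult_le_cancel1 zero_less_numeral zero_less_power)
qed

lemma J_extremal_R_graph_iff:
  assumes q: "admissible n q m" and m: "m > 0"
  shows "J_extremal (R_graph n q m) \<longleftrightarrow>
    (\<forall>p. admissible n p m \<longrightarrow> 3 ^ q * lex_indep p m \<le> 3 ^ p * lex_indep q m)"
proof
  assume ext: "J_extremal (R_graph n q m)"
  show "\<forall>p. admissible n p m \<longrightarrow> 3 ^ q * lex_indep p m \<le> 3 ^ p * lex_indep q m"
  proof (intro allI impI)
    fix p assume p: "admissible n p m"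
    note L = lex_edges_properties[OF p m]
    \<comment> \<open>Competitors must have vertices in \<open>nat\<close>, so the graph with
      parameter \<open>p\<close> is rebuilt there, with \<open>p + 1\<close> up to \<open>n\<close>
      isolated.\<close>
    define G where "G = \<lparr>verts = {1..n}, edges = lex_edges {1..p} m\<rparr>"
    have "p \<le> n" "q \<le> n" using admissible_bounds(2) p q m by blast+
    have G: "simple_graph G"
      using \<open>p \<le> n\<close> lex_edges_subset[of "{1..p}" m]
      by (fastforce simp: simple_graph_def G_def two_subsets_def)
    have "j_count G = 3 ^ (n - p) * lex_indep p m"
      using j_count_eq[OF G] L by (simp add: G_def)
    moreover have "j_count G \<le> j_count (R_graph n q m)"
      using ext G L R_graph_properties[OF q m] by (simp add: J_extremal_def G_def)
    ultimately show "3 ^ q * lex_indep p m \<le> 3 ^ p * lex_indep q m"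
      using R_graph_properties(4)[OF q m] power_diff_mult_le_iff[OF \<open>p \<le> n\<close> \<open>q \<le> n\<close>] by simp
  qed
next
  assume opt: "\<forall>p. admissible n p m \<longrightarrow> 3 ^ q * lex_indep p m \<le> 3 ^ p * lex_indep q m"
  note R = R_graph_properties[OF q m]
  have "j_count G \<le> j_count (R_graph n q m)"
    if G: "simple_graph G" "card (verts G) = n" "card (edges G) = m" for G :: "nat graph"
  proof -
    obtain p where p: "admissible n p m" "j_count G \<le> 3 ^ (n - p) * lex_indep p m"
      using j_count_le[OF G m] by blast
    have "p \<le> n" "q \<le> n" using admissible_bounds(2) p q m by blast+
    then have "3 ^ (n - p) * lex_indep p m \<le> 3 ^ (n - q) * lex_indep q m"
      using opt p(1) by (simp add: power_diff_mult_le_iff)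
    then show ?thesis using p(2) R(4) by simp
  qed
  then show "J_extremal (R_graph n q m)"
    using R by (simp add: J_extremal_def)
qed

theorem theorem4p2:
  fixes m n :: nat
  assumes "m > 0" and "n \<ge> ell m"
  shows "card (verts (R_graph n (ell m) m)) = n \<and>
         card (edges (R_graph n (ell m) m)) = m \<and>
         J_extremal (R_graph n (ell m) m)"
proof -
  let ?A = "{q. admissible (m + 1) q m}"
  let ?B = "{q. admissible (m + 1) q m \<and> J_extremal (R_graph (m + 1) q m)}"
  let ?w = "\<lambda>q. 3 ^ (m + 1 - q) * lex_indep q m"
  have finA: "finite ?A"
    by (rule finite_subset[of _ "{..m + 1}"]) (auto simp: admissible_def)
  have "m + 1 \<in> ?A"
    by (simp add: admissible_def choose_two_Suc)
  then have "?A \<noteq> {}" by blast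
  \<comment> \<open>A best \<open>q\<close> for \<open>m + 1\<close> vertices shows that the set in
    the definition of \<open>ell\<close> is nonempty, so its maximum belongs to it.\<close>
  obtain q where q: "q \<in> ?A" "\<forall>p\<in>?A. ?w p \<le> ?w q"
  proof -
    have "Max (?w ` ?A) \<in> ?w ` ?A" using finA \<open>?A \<noteq> {}\<close> by (intro Max_in) auto
    then obtain q where "q \<in> ?A" "?w q = Max (?w ` ?A)" by fastforce
    then show thesis using that[of q] finA by simp
  qed
  have "J_extremal (R_graph (m + 1) q m)"
  proof (subst J_extremal_R_graph_iff[OF _ assms(1)], use q in simp, intro allI impI)
    fix p assume p: "admissible (m + 1) p m"
    then have "p \<le> m + 1" "q \<le> m + 1" using q(1) by (auto simp: admissible_def)
    then show "3 ^ q * lex_indep p m \<le> 3 ^ p * lex_indep q m"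
      using power_diff_mult_le_iff q(2) p by blast
  qed
  then have "?B \<noteq> {}" using q(1) by blast
  moreover have "finite ?B" using finA by simp
  ultimately have "ell m \<in> ?B"
    unfolding ell_def by (rule Max_in[rotated])
  then have l: "admissible (m + 1) (ell m) m" "J_extremal (R_graph (m + 1) (ell m) m)" by auto
  have n: "admissible n (ell m) m" using l(1) assms(2) by (simp add: admissible_def)
  \<comment> \<open>Admissibility bounds \<open>p\<close> by \<open>m + 1\<close> for every
    \<open>n\<close>, so all competitors on \<open>n\<close> vertices were already considered on
    \<open>m + 1\<close> vertices.\<close>
  have "admissible (m + 1) p m" if "admissible n p m" for p
    using that by (simp add: admissible_def)
  then have "J_extremal (R_graph n (ell m) m)"
    using l J_extremal_R_graph_iff[OF l(1) assms(1)] J_extremal_R_graph_iff[OF n assms(1)] by blast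
  then show ?thesis using R_graph_properties[OF n assms(1)] by blast
qed

end
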